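(* Let $N$ be a positive integer, $\omega=e^{i\pi/N}$, and $n,p\ge0$ integers; put $M=2nN+N+2p$. Then for every $w\in\mathbb{C}$, \[ \sum_{k\ge0}\alpha_{k}^{(N)}\binom{M}{2kN+N}w^{2nN-2kN+2p}= \frac{1}{2^{N}} \sum_{\epsilon\in\{-1,1\}^N} \pi(\epsilon) \left(w+\sum_{j=0}^{N-1}\epsilon_j \omega^{j}\right)^{M}, \] where terms with $2kN+N>M$ vanish.
   Context: The numbers $\alpha_k^{(N)}$ are defined by $\prod_{j=0}^{N-1}\sinh(\omega^{j}z)=\sum_{k\ge0}\alpha_{k}^{(N)}\frac{z^{2kN+N}}{(2kN+N)!}$ with $\omega=e^{i\pi/N}$. For a sign vector $\epsilon=(\epsilon_0,\dots,\epsilon_{N-1})\in\{-1,1\}^N$, its signature is $\pi(\epsilon)=\prod_{j=0}^{N-1}\epsilon_j$. *)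

theory Defs
  imports "HOL-Complex_Analysis.Complex_Analysis"
begin

definition omega :: "nat \<Rightarrow> complex" where
  "omega N = exp (\<i> * of_real pi / of_nat N)"

definition is_alpha :: "nat \<Rightarrow> (nat \<Rightarrow> complex) \<Rightarrow> bool" where
  "is_alpha N a \<longleftrightarrow>
     (\<forall>z. (\<lambda>k. a k * (z ^ (2*k*N + N) / fact (2*k*N + N)))
            sums (\<Prod>j<N. sinh (omega N ^ j * z)))"

text \<open>
  The description is proper for every positive \<open>N\<close>, see \<open>is_alpha_ex1\<close> below.
\<close>

definition alpha :: "nat \<Rightarrow> nat \<Rightarrow> complex" where
  "alpha N = (THE a. is_alpha N a)"

definition sign_vectors :: "nat \<Rightarrow> (nat \<Rightarrow> int) set" where
  "sign_vectors N = (\<Pi>\<^sub>E j\<in>{..<N}. {-1, 1})"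

definition signature :: "nat \<Rightarrow> (nat \<Rightarrow> int) \<Rightarrow> int" where
  "signature N \<epsilon> = (\<Prod>j<N. \<epsilon> j)"

lemma powser_zero_coeffs:
  fixes d :: "nat \<Rightarrow> complex"
  assumes "\<And>z. (\<lambda>n. d n * z ^ n) sums 0"
  shows "d m = 0"
proof (cases "m = 0")
  case True
  from assms[of 0] have "(\<lambda>n. d n * 0 ^ n) sums 0" .
  moreover have "(\<lambda>n. d n * 0 ^ n) sums d 0" by (rule powser_sums_zero)
  ultimately show ?thesis using True sums_unique2 by blast
next
  case False
  show ?thesis
  proof (rule ccontr)
    assume nz: "d m \<noteq> 0"
    obtain s where s: "0 < s" "\<And>z::complex. z \<in> cball 0 s - {0} \<Longrightarrow> (0::complex) \<noteq> 0"
      by (rule powser_0_nonzero[of 1 0 d "\<lambda>_. 0" m]) (use assms nz False in auto)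
    have "complex_of_real s \<in> cball 0 s - {0}" using s(1) by auto
    with s(2) show False by blast
  qed
qed

lemma omega_power_eq_neg1:
  assumes N: "N > 0" and eq: "omega N ^ n = -1"
  shows "\<exists>k. n = 2*k*N + N"
proof -
  have "exp (of_nat n * (\<i> * of_real pi / of_nat N)) = exp (\<i> * of_real pi)"
    unfolding exp_of_nat_mult using eq by (simp add: omega_def)
  then obtain k :: int where
    "of_nat n * (\<i> * of_real pi / of_nat N) = \<i> * of_real pi + (of_int (2*k) * pi) * \<i>"
    unfolding exp_eq by blast
  hence "\<i> * of_real pi * (of_nat n / of_nat N) = \<i> * of_real pi * (1 + 2 * of_int k)"
    by (simp add: field_simps)
  hence "(of_nat n / of_nat N :: complex) = 1 + 2 * of_int k"
    by (subst (asm) mult_left_cancel) simp_all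
  hence "(of_nat n :: complex) = (1 + 2 * of_int k) * of_nat N"
    using N by (simp add: field_simps)
  hence "(of_int (int n) :: complex) = of_int ((1 + 2 * k) * int N)" by simp
  hence n: "int n = (1 + 2 * k) * int N" by (simp only: of_int_eq_iff)
  have "k \<ge> 0"
  proof (rule ccontr)
    assume "\<not> k \<ge> 0"
    hence "(1 + 2 * k) * int N < 0" using N by (intro mult_neg_pos) auto
    with n show False by simp
  qed
  then obtain k' where k': "k = int k'" using nonneg_int_cases by blast
  have "int n = int (2*k'*N + N)" using n k' by (simp add: algebra_simps)
  thus ?thesis unfolding of_nat_eq_iff by blast
qed

lemma strict_mono_index:
  "N > 0 \<Longrightarrow> strict_mono (\<lambda>k::nat. 2*k*N + N)"
  by (rule strict_monoI) simp

lemma sinh_prod_rotate: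
  assumes N: "N > 0"
  shows "(\<Prod>j<N. sinh (omega N ^ j * (omega N * z))) = - (\<Prod>j<N. sinh (omega N ^ j * z))"
proof -
  obtain m where m: "N = Suc m" using N gr0_implies_Suc by blast
  have wN: "omega N ^ N = -1"
    using N by (simp add: omega_def flip: exp_of_nat_mult)
  have "(\<Prod>j<N. sinh (omega N ^ j * (omega N * z))) = (\<Prod>j<Suc m. sinh (omega N ^ Suc j * z))"
    by (simp add: m mult_ac)
  also have "\<dots> = (\<Prod>j<m. sinh (omega N ^ Suc j * z)) * sinh (omega N ^ N * z)"
    by (simp add: m)
  also have "\<dots> = - (sinh (omega N ^ 0 * z) * (\<Prod>j<m. sinh (omega N ^ Suc j * z)))"
    unfolding wN by simp
  also have "\<dots> = - (\<Prod>j<Suc m. sinh (omega N ^ j * z))"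
    by (subst prod.lessThan_Suc_shift) simp
  finally show ?thesis by (simp only: m)
qed

lemma is_alpha_ex1:
  assumes N: "N > 0"
  shows "\<exists>!a. is_alpha N a"
proof (rule ex_ex1I)
  define f where "f = (\<lambda>z. \<Prod>j<N. sinh (omega N ^ j * z))"
  define c where "c n = (deriv ^^ n) f 0 / fact n" for n
  have "f holomorphic_on UNIV"
    unfolding f_def sinh_def by (intro holomorphic_intros)
  hence c: "(\<lambda>n. c n * z ^ n) sums f z" for z
    using holomorphic_power_series[of f 0 "norm z + 1" z] holomorphic_on_subset[of f UNIV]
    by (simp add: c_def)
  have "(c n * (omega N ^ n + 1)) = 0" for n
  proof (rule powser_zero_coeffs[where d = "\<lambda>n. c n * (omega N ^ n + 1)"])
    fix z
    have "f (omega N * z) = - f z"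
      using sinh_prod_rotate[OF N] by (simp add: f_def)
    thus "(\<lambda>n. c n * (omega N ^ n + 1) * z ^ n) sums 0"
      using sums_add[OF c[of "omega N * z"] c[of z]]
      by (simp add: algebra_simps power_mult_distrib)
  qed
  hence "c n = 0 \<or> omega N ^ n = -1" for n
    by (simp add: eq_neg_iff_add_eq_0)
  hence z: "c n = 0" if "n \<notin> range (\<lambda>k. 2*k*N + N)" for n
    using omega_power_eq_neg1[OF N, of n] that by blast
  have "is_alpha N (\<lambda>k. c (2*k*N + N) * fact (2*k*N + N))"
    unfolding is_alpha_def
  proof
    fix x
    show "(\<lambda>k. c (2*k*N + N) * fact (2*k*N + N) * (x ^ (2*k*N + N) / fact (2*k*N + N)))
            sums (\<Prod>j<N. sinh (omega N ^ j * x))"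
      using sums_mono_reindex[OF strict_mono_index[OF N], of "\<lambda>n. c n * x ^ n" "f x"] z c[of x]
      by (simp add: f_def)
  qed
  thus "\<exists>a. is_alpha N a" by blast
next
  fix a b assume ab: "is_alpha N a" "is_alpha N b"
  let ?g = "\<lambda>k. 2*k*N + N"
  have inj: "inj ?g" using strict_mono_index[OF N] strict_mono_imp_inj_on by blast
  define d where "d n = (if n \<in> range ?g then (a (inv ?g n) - b (inv ?g n)) / fact n else 0)" for n
  have dg: "d (?g k) = (a k - b k) / fact (?g k)" for k
    unfolding d_def inv_f_f[OF inj] by (rule if_P) blast
  have "d n = 0" for n
  proof (rule powser_zero_coeffs)
    fix x
    have "(\<lambda>k. d (?g k) * x ^ ?g k) sums 0"
      using sums_diff[OF ab(1)[unfolded is_alpha_def, rule_format, of x]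
                         ab(2)[unfolded is_alpha_def, rule_format, of x]]
      unfolding dg by (simp add: algebra_simps diff_divide_distrib)
    thus "(\<lambda>n. d n * x ^ n) sums 0"
      using sums_mono_reindex[OF strict_mono_index[OF N], of "\<lambda>n. d n * x ^ n" 0]
      by (simp add: d_def)
  qed
  hence "(a k - b k) / fact (?g k) = 0" for k by (simp add: dg [symmetric])
  thus "a = b" by (intro ext) simp
qed

end

theory Submission
  imports Defs
begin

text \<open>
  Expanding every \<open>sinh\<close> into exponentials writes the product as
  \<open>2\<^sup>-\<^sup>N \<Sum>\<^sub>\<epsilon> \<pi>(\<epsilon>) exp (S(\<epsilon>) z)\<close> with \<open>S(\<epsilon>) = \<Sum>\<^sub>j \<epsilon>\<^sub>j \<omega>\<^sup>j\<close>, so \<open>\<alpha>\<^sub>k\<close> is the signed moment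
  \<open>2\<^sup>-\<^sup>N \<Sum>\<^sub>\<epsilon> \<pi>(\<epsilon>) S(\<epsilon>)\<^sup>m\<close> at \<open>m = 2kN + N\<close>. As the product changes sign under
  \<open>z \<mapsto> \<omega>z\<close>, all other moments vanish, and the binomial theorem applied to
  \<open>(w + S(\<epsilon>))\<^sup>M\<close> leaves exactly the terms with \<open>m = 2kN + N\<close>.
\<close>

definition signed_sum :: "nat \<Rightarrow> (nat \<Rightarrow> int) \<Rightarrow> complex" where
  "signed_sum N \<epsilon> = (\<Sum>j<N. of_int (\<epsilon> j) * omega N ^ j)"

definition signed_moment :: "nat \<Rightarrow> nat \<Rightarrow> complex" where
  "signed_moment N m =
     1 / 2 ^ N * (\<Sum>\<epsilon>\<in>sign_vectors N. of_int (signature N \<epsilon>) * signed_sum N \<epsilon> ^ m)"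

lemma sinh_prod_eq_sum_exp:
  "(\<Prod>j<N. sinh (omega N ^ j * z)) =
     1 / 2 ^ N * (\<Sum>\<epsilon>\<in>sign_vectors N. of_int (signature N \<epsilon>) * exp (signed_sum N \<epsilon> * z))"
proof -
  \<comment> \<open>Written as a sum over the two signs, each factor lets
    \<open>prod_sum_PiE\<close> turn the product into a sum over sign vectors.\<close>
  have "sinh x = (\<Sum>e\<in>{-1, 1::int}. of_int e * exp (of_int e * x)) / 2" for x :: complex
    by (simp add: sinh_field_def)
  hence "(\<Prod>j<N. sinh (omega N ^ j * z)) =
      (\<Prod>j<N. \<Sum>e\<in>{-1, 1::int}. of_int e * exp (of_int e * (omega N ^ j * z))) / 2 ^ N"
    by (simp only: prod_dividef prod_constant card_lessThan)
  also have "(\<Prod>j<N. \<Sum>e\<in>{-1, 1::int}. of_int e * exp (of_int e * (omega N ^ j * z))) =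
      (\<Sum>\<epsilon>\<in>sign_vectors N. \<Prod>j<N. of_int (\<epsilon> j) * exp (of_int (\<epsilon> j) * (omega N ^ j * z)))"
    unfolding sign_vectors_def by (rule prod_sum_PiE) auto
  also have "\<dots> = (\<Sum>\<epsilon>\<in>sign_vectors N. of_int (signature N \<epsilon>) * exp (signed_sum N \<epsilon> * z))"
    by (simp add: prod.distrib signature_def signed_sum_def sum_distrib_right exp_sum mult.assoc)
  finally show ?thesis by simp
qed

lemma signed_moment_sums_sinh_prod:
  "(\<lambda>m. signed_moment N m / fact m * z ^ m) sums (\<Prod>j<N. sinh (omega N ^ j * z))"
proof -
  have "(\<lambda>m. x ^ m / fact m) sums exp x" for x :: complex
    using exp_converges[of x] by (simp add: scaleR_conv_of_real field_simps)
  hence "(\<lambda>m. 1 / 2 ^ N * (\<Sum>\<epsilon>\<in>sign_vectors N.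
            of_int (signature N \<epsilon>) * ((signed_sum N \<epsilon> * z) ^ m / fact m)))
         sums (1 / 2 ^ N * (\<Sum>\<epsilon>\<in>sign_vectors N.
            of_int (signature N \<epsilon>) * exp (signed_sum N \<epsilon> * z)))"
    by (intro sums_mult sums_sum)
  thus ?thesis
    unfolding sinh_prod_eq_sum_exp
    by (simp add: signed_moment_def sum_distrib_right sum_distrib_left
        sum_divide_distrib power_mult_distrib mult_ac)
qed

text \<open>Adding the series at \<open>omega N * z\<close> and at \<open>z\<close> gives zero, so
  each coefficient is killed by the factor \<open>omega N ^ m + 1\<close>, which vanishes only at
  odd multiples of \<open>N\<close>.\<close>

lemma signed_moment_eq_0:
  assumes N: "N > 0" and m: "m \<notin> range (\<lambda>k. 2*k*N + N)"
  shows "signed_moment N m = 0"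
proof -
  have "signed_moment N m / fact m * (omega N ^ m + 1) = 0"
  proof (rule powser_zero_coeffs[where d = "\<lambda>m. signed_moment N m / fact m * (omega N ^ m + 1)"])
    fix z
    show "(\<lambda>m. signed_moment N m / fact m * (omega N ^ m + 1) * z ^ m) sums 0"
      using sums_add[OF signed_moment_sums_sinh_prod[of N "omega N * z"]
          signed_moment_sums_sinh_prod[of N z]]
      unfolding sinh_prod_rotate[OF N]
      by (simp add: ring_distribs power_mult_distrib mult_ac add_divide_distrib)
  qed
  moreover have "omega N ^ m \<noteq> -1"
    using omega_power_eq_neg1[OF N] m by blast
  ultimately show ?thesis
    by (simp add: eq_neg_iff_add_eq_0)
qed

text \<open>Reindexing the moment series drops only zero terms, so these moments satisfy
  \<open>is_alpha\<close>; uniqueness does the rest.\<close>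

lemma alpha_eq_signed_moment:
  assumes N: "N > 0"
  shows "alpha N k = signed_moment N (2*k*N + N)"
proof -
  have "is_alpha N (\<lambda>k. signed_moment N (2*k*N + N))"
    unfolding is_alpha_def
  proof
    fix z
    show "(\<lambda>k. signed_moment N (2*k*N + N) * (z ^ (2*k*N + N) / fact (2*k*N + N)))
            sums (\<Prod>j<N. sinh (omega N ^ j * z))"
      using sums_mono_reindex[OF strict_mono_index[OF N],
          of "\<lambda>m. signed_moment N m / fact m * z ^ m"]
        signed_moment_eq_0[OF N] signed_moment_sums_sinh_prod[of N z]
      by simp
  qed
  thus ?thesis
    unfolding alpha_def using the1_equality[OF is_alpha_ex1[OF N]] by metis
qed

lemma signed_binomial_expansion:
  "1 / 2 ^ N * (\<Sum>\<epsilon>\<in>sign_vectors N. of_int (signature N \<epsilon>) * (w + signed_sum N \<epsilon>) ^ M) =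
     (\<Sum>m\<le>M. signed_moment N m * of_nat (M choose m) * w ^ (M - m))"
proof -
  have "(w + signed_sum N \<epsilon>) ^ M =
      (\<Sum>m\<le>M. of_nat (M choose m) * signed_sum N \<epsilon> ^ m * w ^ (M - m))" for \<epsilon>
    by (subst add.commute) (rule binomial_ring)
  hence "(\<Sum>\<epsilon>\<in>sign_vectors N. of_int (signature N \<epsilon>) * (w + signed_sum N \<epsilon>) ^ M) =
      (\<Sum>m\<le>M. \<Sum>\<epsilon>\<in>sign_vectors N. of_int (signature N \<epsilon>) *
         (of_nat (M choose m) * signed_sum N \<epsilon> ^ m * w ^ (M - m)))"
    by (simp add: sum_distrib_left sum.swap[of _ "{..M}"])
  thus ?thesis
    by (simp add: signed_moment_def sum_distrib_left sum_distrib_right sum_divide_distrib mult_ac)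
qed

theorem theorem2:
  fixes N n p M :: nat and w :: complex
  assumes "N > 0"
    and "M = 2*n*N + N + 2*p"
  shows "(\<lambda>k. alpha N k * of_nat (M choose (2*k*N + N)) * w powi (2*int n*int N - 2*int k*int N + 2*int p))
           sums
         (1 / 2 ^ N * (\<Sum>\<epsilon>\<in>sign_vectors N.
            of_int (signature N \<epsilon>) * (w + (\<Sum>j<N. of_int (\<epsilon> j) * omega N ^ j)) ^ M))"
proof -
  let ?t = "\<lambda>m. signed_moment N m * of_nat (M choose m) * w ^ (M - m)"
  \<comment> \<open>The binomial coefficient vanishes for \<open>m > M\<close>, so the finite sum is
    also an infinite series and can be reindexed.\<close>
  have "?t sums (\<Sum>m\<le>M. ?t m)"
    by (rule sums_finite) auto
  hence "(\<lambda>k. ?t (2*k*N + N)) sums (\<Sum>m\<le>M. ?t m)"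
    using sums_mono_reindex[OF strict_mono_index[OF assms(1)], of ?t]
      signed_moment_eq_0[OF assms(1)] by simp
  moreover have "?t (2*k*N + N) = alpha N k * of_nat (M choose (2*k*N + N)) *
      w powi (2*int n*int N - 2*int k*int N + 2*int p)" for k
  \<comment> \<open>Otherwise the integer exponent is negative while \<open>M - (2*k*N + N)\<close>
    truncates to 0, but the zero binomial coefficient makes both sides 0.\<close>
  proof (cases "2*k*N + N \<le> M")
    case True
    hence "2*int n*int N - 2*int k*int N + 2*int p = int (M - (2*k*N + N))"
      using assms(2) by (simp add: of_nat_diff)
    thus ?thesis
      by (simp only: power_int_of_nat alpha_eq_signed_moment[OF assms(1)])
  qed simp
  ultimately show ?thesis
    unfolding signed_binomial_expansion[symmetric] signed_sum_def by simp
qed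

end
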